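(* For all $s \in \mathbb{N}$, $u \in \ell^2(\mathbb{Z})$, $n \in \mathbb{Z}$ it holds that $$\big((-\Delta)^s u\big)(n) = \sum_{k=0}^{2s} (-1)^{k-s}\binom{2s}{k}\,u(n-s+k) = \lim_{z\to s}\left[\sum_{k\in\mathbb{Z}} K_z(n-k)\,\big(u(n)-u(k)\big)\right],$$ where the limit is taken over $z$ in the domain $(0,\infty)\setminus\mathbb{N}$ on which $K_z$ is defined.
   Context: $\mathbb{N} = \{1,2,3,\ldots\}$. $\ell^2(\mathbb{Z})$ is the set of all $u \colon \mathbb{Z} \to \mathbb{R}$ with $\sum_{k\in\mathbb{Z}} |u(k)|^2 < \infty$. $\Gamma$ is the Gamma function (meromorphically continued). The discrete Laplace operator $\Delta \colon \ell^2(\mathbb{Z}) \to \ell^2(\mathbb{Z})$ is $(\Delta u)(n) = u(n-1) - 2u(n) + u(n+1)$. Integer powers are defined by iteration: $(-\Delta)^0 u = u$ and $(-\Delta)^k u = -\Delta\big((-\Delta)^{k-1}u\big)$ for $k\in\mathbb{N}$. The discrete fractional kernel: for $z \in (0,\infty)\setminus\mathbb{N}$ the function $K_z \colon \mathbb{Z}\to\mathbb{R}$ is given by $K_z(0)=0$ and, for $k \ne 0$, $$K_z(k) = \frac{-4^z\,\Gamma(\tfrac12+z)\,\Gamma(|k|-z)}{\sqrt{\pi}\,\Gamma(-z)\,\Gamma(|k|+1+z)}.$$ *)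

theory Defs
  imports "HOL-Analysis.Analysis"
begin

definition ell2_int :: "(int \<Rightarrow> real) set" where
  "ell2_int = {u. (\<lambda>k. \<bar>u k\<bar> ^ 2) summable_on UNIV}"

text \<open>The operators are total on all sequences; on \<open>ell2_int\<close> they are endomorphisms, see
  \<open>discrete_laplacian_ell2_int\<close> and \<open>neg_discrete_laplacian_funpow_ell2_int\<close> below.\<close>

definition discrete_laplacian :: "(int \<Rightarrow> real) \<Rightarrow> int \<Rightarrow> real" where
  "discrete_laplacian u = (\<lambda>n. u (n - 1) - 2 * u n + u (n + 1))"

definition neg_discrete_laplacian :: "(int \<Rightarrow> real) \<Rightarrow> int \<Rightarrow> real" where
  "neg_discrete_laplacian u = (\<lambda>n. - discrete_laplacian u n)"

text \<open>The intended domain of the parameter is \<open>z \<in> {0<..} - \<nat>\<close>. There no Gamma argument below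
  is a pole, so the library convention \<open>Gamma x = 0\<close> at poles is never used.\<close>

definition frac_kernel :: "real \<Rightarrow> int \<Rightarrow> real" where
  "frac_kernel z k =
     (if k = 0 then 0
      else - (4 powr z) * Gamma (1/2 + z) * Gamma (real_of_int \<bar>k\<bar> - z) /
             (sqrt pi * Gamma (- z) * Gamma (real_of_int \<bar>k\<bar> + 1 + z)))"

lemma ell2_int_shift:
  assumes "u \<in> ell2_int"
  shows "(\<lambda>n. u (n + c)) \<in> ell2_int"
proof -
  have "bij_betw (\<lambda>n::int. n + c) UNIV UNIV"
    by (rule bij_betwI[where g = "\<lambda>n. n - c"]) auto
  from summable_on_reindex_bij_betw[OF this, of "\<lambda>k. \<bar>u k\<bar> ^ 2"] assms
  show ?thesis by (simp add: ell2_int_def)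
qed

lemma discrete_laplacian_ell2_int:
  assumes "u \<in> ell2_int"
  shows "discrete_laplacian u \<in> ell2_int"
proof -
  let ?g = "\<lambda>n. 4 * (\<bar>u (n + - 1)\<bar> ^ 2 + 4 * \<bar>u n\<bar> ^ 2 + \<bar>u (n + 1)\<bar> ^ 2)"
  have "?g summable_on UNIV"
    using ell2_int_shift[OF assms, of "- 1"] ell2_int_shift[OF assms, of 1] assms
    unfolding ell2_int_def mem_Collect_eq
    by (intro summable_on_cmult_right summable_on_add)
  moreover have "\<bar>discrete_laplacian u n\<bar> ^ 2 \<le> ?g n" for n
  proof -
    have "(a - 2 * b + c)\<^sup>2 \<le> 4 * (a\<^sup>2 + 4 * b\<^sup>2 + c\<^sup>2)" for a b c :: real
    proof -
      have "4 * (a\<^sup>2 + 4 * b\<^sup>2 + c\<^sup>2) - (a - 2 * b + c)\<^sup>2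
              = (a + 2 * b)\<^sup>2 + (a - c)\<^sup>2 + (2 * b + c)\<^sup>2 + a\<^sup>2 + 4 * b\<^sup>2 + c\<^sup>2"
        by (simp add: power2_eq_square algebra_simps)
      also have "\<dots> \<ge> 0" by simp
      finally show ?thesis by simp
    qed
    thus ?thesis by (simp add: discrete_laplacian_def)
  qed
  ultimately show ?thesis
    unfolding ell2_int_def mem_Collect_eq
    by (rule summable_on_comparison_test) auto
qed

lemma neg_discrete_laplacian_funpow_ell2_int:
  assumes "u \<in> ell2_int"
  shows "(neg_discrete_laplacian ^^ s) u \<in> ell2_int"
proof (induction s)
  case (Suc s)
  from discrete_laplacian_ell2_int[OF this]
  show ?case by (simp add: ell2_int_def neg_discrete_laplacian_def)
qed (use assms in simp)

end

theory Submission
  imports Defs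
begin

text \<open>
  The integer power is a binomial sum because \<open>-\<Delta> = - E\<^sup>-\<^sup>1 (E - 1)\<^sup>2\<close>, where \<open>E\<close> is the shift
  \<open>u \<mapsto> u (\<cdot> + 1)\<close>: its \<open>s\<close>-th power is \<open>(-1)\<^sup>s E\<^sup>-\<^sup>s (E - 1)\<^sup>2\<^sup>s\<close>, and powers of \<open>E - 1\<close> expand by the
  binomial theorem.

  For the limit, rewrite \<open>\<Gamma>(|j| - z) / \<Gamma>(-z)\<close> as the polynomial \<open>(-z)(1 - z)\<cdots>(|j| - 1 - z)\<close>. This
  removes the singular quotient of the kernel at \<open>z = s\<close> and gives
  \<open>K\<^sub>z(j) \<rightarrow> - (-1)\<^sup>j (2s choose s + |j|)\<close> for \<open>j \<noteq> 0\<close> (\<open>tendsto_frac_kernel\<close>). The limit vanishes for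
  \<open>|j| > s\<close>, so only the offsets \<open>|j| \<le> s\<close> survive. Their terms tend to
  \<open>(-1)\<^sup>j (2s choose s + j) (u(n - j) - u(n))\<close>, and the part with \<open>u(n)\<close> sums to zero, since alternating
  binomial sums do.

  It remains to see that the infinite tail over \<open>|j| > s\<close> tends to zero as a whole, not only term by
  term. The functional equation of \<open>\<Gamma>\<close> gives \<open>(m + 1 + z) K\<^sub>z(m + 1) = (m - z) K\<^sub>z(m)\<close>, so that
  \<open>2z |K\<^sub>z(m)| = (m + z) |K\<^sub>z(m)| - (m + 1 + z) |K\<^sub>z(m + 1)|\<close> for \<open>m \<ge> z\<close>. The sum telescopes: the tail
  from \<open>M \<ge> z\<close> on, counted on both sides, is at most \<open>(M + z) |K\<^sub>z(M)| / z\<close>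
  (\<open>sum_abs_frac_kernel_le\<close>). This proves summability for every \<open>z\<close>, as \<open>u\<close> is bounded. With
  \<open>M = s + 1\<close> it bounds the tail by a multiple of the single value \<open>K\<^sub>z(s + 1)\<close>, which tends to zero.
\<close>

section \<open>Integer powers as central differences\<close>

definition forward_difference :: "(int \<Rightarrow> real) \<Rightarrow> int \<Rightarrow> real" where
  "forward_difference u = (\<lambda>n. u (n + 1) - u n)"

text \<open>The induction step is Pascal's rule, once both sums are indexed by the same values of \<open>u\<close>.\<close>

lemma forward_difference_funpow:
  "(forward_difference ^^ m) u n = (\<Sum>k\<le>m. (- 1) ^ (m + k) * real (m choose k) * u (n + int k))"
proof (induction m arbitrary: n)
  case (Suc m)
  let ?t = "\<lambda>k. (- 1) ^ (m + k) * real (m choose k)"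
  \<comment> \<open>The added term carries \<open>m choose Suc m = 0\<close>; with it the \<open>k = 0\<close> term can be split off.\<close>
  have "(\<Sum>k\<le>m. ?t k * u (n + int k)) = (\<Sum>k\<le>Suc m. ?t k * u (n + int k))"
    by simp
  also have "\<dots> = ?t 0 * u n + (\<Sum>k\<le>m. ?t (Suc k) * u (n + int (Suc k)))"
    by (subst sum.atMost_Suc_shift) simp
  finally have "(forward_difference ^^ Suc m) u n =
      (\<Sum>k\<le>m. ?t k * u (n + int (Suc k))) - (?t 0 * u n + (\<Sum>k\<le>m. ?t (Suc k) * u (n + int (Suc k))))"
    using Suc.IH[of n] Suc.IH[of "n + 1"]
    by (simp add: forward_difference_def[of "(forward_difference ^^ m) u"] add_ac)
  also have "\<dots> = (\<Sum>k\<le>Suc m. (- 1) ^ (Suc m + k) * real (Suc m choose k) * u (n + int k))"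
    unfolding sum.atMost_Suc_shift[of _ m]
    by (simp add: algebra_simps sum.distrib sum_negf)
  finally show ?case .
qed simp

text \<open>One step of the operator is a second forward difference, taken one place to the left and
  negated; the shift commutes with the differences.\<close>

lemma neg_discrete_laplacian_funpow_eq_forward_difference:
  "(neg_discrete_laplacian ^^ s) u n = (- 1) ^ s * (forward_difference ^^ (2 * s)) u (n - int s)"
  by (induction s arbitrary: n)
     (simp_all add: neg_discrete_laplacian_def discrete_laplacian_def forward_difference_def algebra_simps)

lemma minus_one_powi_diff: "(- 1 :: real) powi (int k - int s) = (- 1) ^ (k + s)"
  by (simp add: power_int_diff power_add power_int_minus_one_minus divide_inverse flip: power_inverse)

lemma neg_discrete_laplacian_funpow:
  "(neg_discrete_laplacian ^^ s) u n =
     (\<Sum>k = 0..2 * s. (- 1) powi (int k - int s) * real (2 * s choose k) * u (n - int s + int k))"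
  unfolding neg_discrete_laplacian_funpow_eq_forward_difference forward_difference_funpow
    sum_distrib_left atLeast0AtMost minus_one_powi_diff
  by (intro sum.cong) (simp_all add: power_add)

section \<open>The tail of the kernel\<close>

lemma frac_kernel_Suc:
  assumes "z \<notin> \<nat>" "0 < z" "m \<ge> 1"
  shows "frac_kernel z (int (Suc m)) * (real (Suc m) + z) = frac_kernel z (int m) * (real m - z)"
proof -
  have "real m - z \<notin> \<int>\<^sub>\<le>\<^sub>0"
  proof
    assume "real m - z \<in> \<int>\<^sub>\<le>\<^sub>0"
    then obtain i where "real m - z = - real i"
      by (auto elim!: nonpos_Ints_cases')
    then have "z = real (m + i)" by simp
    then show False using \<open>z \<notin> \<nat>\<close> of_nat_in_Nats by metis
  qed
  then have num: "Gamma (real (Suc m) - z) = (real m - z) * Gamma (real m - z)"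
    using Gamma_plus1[of "real m - z"] by (simp add: algebra_simps)
  have "real (Suc m) + z \<notin> \<int>\<^sub>\<le>\<^sub>0"
    using \<open>0 < z\<close> by (auto elim!: nonpos_Ints_cases')
  then have den: "Gamma (real (Suc m) + 1 + z) = (real (Suc m) + z) * Gamma (real m + 1 + z)"
    using Gamma_plus1[of "real (Suc m) + z"] by (simp add: add_ac)
  have "real (Suc m) + z \<noteq> 0" using \<open>0 < z\<close> by simp
  with \<open>m \<ge> 1\<close> show ?thesis
    by (simp add: frac_kernel_def num den mult_ac del: of_nat_Suc)
qed

lemma frac_kernel_abs: "frac_kernel z \<bar>k\<bar> = frac_kernel z k"
  by (simp add: frac_kernel_def)

text \<open>For \<open>m \<ge> z\<close> the recurrence has nonnegative factors and holds for absolute values. As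
  \<open>m - z = (m + z) - 2 z\<close>, it makes \<open>2 z |K\<^sub>z(m)|\<close> a difference of consecutive values of
  \<open>(m + z) |K\<^sub>z(m)|\<close>.\<close>

lemma sum_frac_kernel_tail:
  assumes "z \<notin> \<nat>" "0 < z" "z \<le> real M" "M \<ge> 1"
  shows "2 * z * (\<Sum>m = M..<M + N. \<bar>frac_kernel z (int m)\<bar>) =
    (real M + z) * \<bar>frac_kernel z (int M)\<bar> - (real (M + N) + z) * \<bar>frac_kernel z (int (M + N))\<bar>"
proof (induction N)
  case (Suc N)
  have "\<bar>frac_kernel z (int (Suc (M + N))) * (real (Suc (M + N)) + z)\<bar> =
      \<bar>frac_kernel z (int (M + N)) * (real (M + N) - z)\<bar>"
    using assms by (subst frac_kernel_Suc) auto
  then have "\<bar>frac_kernel z (int (Suc (M + N)))\<bar> * (real (Suc (M + N)) + z) =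
      \<bar>frac_kernel z (int (M + N))\<bar> * (real (M + N) - z)"
    using assms by (simp add: abs_mult)
  then show ?case using Suc.IH by (simp add: algebra_simps)
qed simp

text \<open>The factor \<open>2\<close> of the telescoping identity is used up by the two signs of \<open>j\<close>.\<close>

lemma sum_abs_frac_kernel_le:
  assumes z: "z \<notin> \<nat>" "0 < z" "z \<le> real M" "M \<ge> 1"
    and F: "finite F" "F \<subseteq> {j. int M \<le> \<bar>j\<bar>}"
  shows "(\<Sum>j\<in>F. \<bar>frac_kernel z j\<bar>) \<le> (real M + z) * \<bar>frac_kernel z (int M)\<bar> / z"
proof -
  obtain N where N: "nat \<bar>j\<bar> \<le> N" if "j \<in> F" for j
    using F(1) finite_nat_set_iff_bounded_le[of "(\<lambda>j. nat \<bar>j\<bar>) ` F"] by auto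
  let ?I = "{M..<M + Suc N}"
  have sub: "F \<subseteq> int ` ?I \<union> (\<lambda>m. - int m) ` ?I"
  proof
    fix j assume "j \<in> F"
    then have "nat \<bar>j\<bar> \<in> ?I" using N[of j] F(2) by auto
    moreover have "j = int (nat \<bar>j\<bar>) \<or> j = - int (nat \<bar>j\<bar>)" by auto
    ultimately show "j \<in> int ` ?I \<union> (\<lambda>m. - int m) ` ?I" by blast
  qed
  have "(\<Sum>j\<in>F. \<bar>frac_kernel z j\<bar>) \<le> (\<Sum>j\<in>int ` ?I \<union> (\<lambda>m. - int m) ` ?I. \<bar>frac_kernel z j\<bar>)"
    by (intro sum_mono2 sub) auto
  also have "\<dots> \<le> (\<Sum>j\<in>int ` ?I. \<bar>frac_kernel z j\<bar>) + (\<Sum>j\<in>(\<lambda>m. - int m) ` ?I. \<bar>frac_kernel z j\<bar>)"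
    by (subst sum_Un) (auto intro: sum_nonneg)
  also have "\<dots> = 2 * (\<Sum>m\<in>?I. \<bar>frac_kernel z (int m)\<bar>)"
  proof -
    have "frac_kernel z (- int m) = frac_kernel z (int m)" for m
      using frac_kernel_abs[of z "- int m"] by simp
    then show ?thesis by (simp add: sum.reindex inj_on_def del: sum.op_ivl_Suc)
  qed
  also have "\<dots> \<le> (real M + z) * \<bar>frac_kernel z (int M)\<bar> / z"
  proof -
    have "2 * z * (\<Sum>m\<in>?I. \<bar>frac_kernel z (int m)\<bar>) \<le> (real M + z) * \<bar>frac_kernel z (int M)\<bar>"
      using sum_frac_kernel_tail[OF z, of "Suc N"] \<open>0 < z\<close> by simp
    then show ?thesis using \<open>0 < z\<close> by (simp add: pos_le_divide_eq algebra_simps del: sum.op_ivl_Suc)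
  qed
  finally show ?thesis .
qed

text \<open>The bound on finite sums is independent of the finite set, so it gives absolute summability and
  at the same time bounds the infinite sum.\<close>

lemma frac_kernel_tail_bounded:
  fixes n :: int
  assumes z: "z \<notin> \<nat>" "0 < z" "z \<le> real M" "M \<ge> 1" and v: "\<And>k. \<bar>v k\<bar> \<le> C"
  defines "T \<equiv> {k. int M \<le> \<bar>n - k\<bar>}"
  shows "(\<lambda>k. frac_kernel z (n - k) * v k) summable_on T"
    and "\<bar>\<Sum>\<^sub>\<infinity>k\<in>T. frac_kernel z (n - k) * v k\<bar>
           \<le> C * ((real M + z) * \<bar>frac_kernel z (int M)\<bar> / z)"
proof -
  let ?B = "C * ((real M + z) * \<bar>frac_kernel z (int M)\<bar> / z)"
  have "C \<ge> 0" using v[of 0] by linarith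
  have *: "(\<Sum>k\<in>G. norm (frac_kernel z (n - k) * v k)) \<le> ?B" if "finite G" "G \<subseteq> T" for G
  proof -
    have "(\<Sum>k\<in>G. norm (frac_kernel z (n - k) * v k)) \<le> (\<Sum>k\<in>G. C * \<bar>frac_kernel z (n - k)\<bar>)"
      using v by (intro sum_mono) (simp add: abs_mult mult.commute mult_right_mono)
    also have "\<dots> = C * (\<Sum>j\<in>(-) n ` G. \<bar>frac_kernel z j\<bar>)"
      by (simp add: sum.reindex inj_on_def sum_distrib_left)
    also have "\<dots> \<le> ?B"
      using that \<open>C \<ge> 0\<close> by (intro mult_left_mono sum_abs_frac_kernel_le z) (auto simp: T_def)
    finally show ?thesis .
  qed
  then have abs: "(\<lambda>k. norm (frac_kernel z (n - k) * v k)) summable_on T"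
    by (intro nonneg_bdd_above_summable_on bdd_aboveI2[where M = ?B]) auto
  then show "(\<lambda>k. frac_kernel z (n - k) * v k) summable_on T"
    by (rule abs_summable_summable)
  have "norm (\<Sum>\<^sub>\<infinity>k\<in>T. frac_kernel z (n - k) * v k) \<le> (\<Sum>\<^sub>\<infinity>k\<in>T. norm (frac_kernel z (n - k) * v k))"
    by (rule norm_infsum_bound[OF abs])
  also have "\<dots> \<le> ?B" by (rule infsum_le_finite_sums[OF abs *])
  finally show "\<bar>\<Sum>\<^sub>\<infinity>k\<in>T. frac_kernel z (n - k) * v k\<bar> \<le> ?B" by simp
qed

section \<open>The kernel at integer order\<close>

text \<open>Legendre's duplication formula at integers; it turns the prefactor of the kernel into factorials.\<close>

lemma Gamma_half_plus_nat:
  "4 ^ s * Gamma (1 / 2 + real s) / sqrt pi = fact (2 * s) / fact s"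
proof (induction s)
  case (Suc s)
  have "1 / 2 + real s \<notin> \<int>\<^sub>\<le>\<^sub>0"
  proof
    assume "1 / 2 + real s \<in> \<int>\<^sub>\<le>\<^sub>0"
    then have "1 / 2 + real s \<le> 0" by (rule nonpos_Ints_nonpos)
    then show False by simp
  qed
  then have "Gamma (1 / 2 + real (Suc s)) = (1 / 2 + real s) * Gamma (1 / 2 + real s)"
    using Gamma_plus1[of "1 / 2 + real s"] by (simp add: add_ac)
  then have "4 ^ Suc s * Gamma (1 / 2 + real (Suc s)) / sqrt pi =
      4 * (1 / 2 + real s) * (4 ^ s * Gamma (1 / 2 + real s) / sqrt pi)"
    by simp
  also have "\<dots> = fact (2 * Suc s) / fact (Suc s)"
    unfolding Suc.IH by (simp add: divide_simps) (simp add: algebra_simps)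
  finally show ?case .
qed (simp add: Gamma_one_half_real)

text \<open>The right-hand side is continuous in \<open>z > 0\<close>, also at integers, where the defining formula
  divides by a value of \<open>\<Gamma>\<close> at a pole.\<close>

lemma frac_kernel_eq_pochhammer:
  assumes "z \<notin> \<nat>" "j \<noteq> 0"
  shows "frac_kernel z j = - (4 powr z * Gamma (1 / 2 + z) / sqrt pi *
    pochhammer (- z) (nat \<bar>j\<bar>) / Gamma (real (nat \<bar>j\<bar>) + 1 + z))"
proof -
  have "- z \<notin> \<int>\<^sub>\<le>\<^sub>0"
    using \<open>z \<notin> \<nat>\<close> by (auto elim!: nonpos_Ints_cases')
  then show ?thesis
    using \<open>j \<noteq> 0\<close> by (simp add: frac_kernel_def pochhammer_Gamma)
qed

text \<open>For \<open>m > s\<close> both sides are zero: the rising factorial of \<open>-s\<close> then has the factor \<open>0\<close>.\<close>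

lemma central_binomial_eq_pochhammer:
  "fact (2 * s) / fact s * pochhammer (- real s) m / fact (m + s) =
     (- 1) ^ m * real (2 * s choose (s + m))"
proof -
  have "pochhammer (- real s) m = (- 1) ^ m * fact m * real (s choose m)"
    by (simp add: gbinomial_pochhammer binomial_gbinomial)
  then show ?thesis
    by (cases "m \<le> s") (simp_all add: binomial_fact binomial_eq_0 not_le mult.commute add.commute)
qed

lemma tendsto_frac_kernel:
  assumes "j \<noteq> 0"
  shows "((\<lambda>z. frac_kernel z j) \<longlongrightarrow> - ((- 1) ^ nat \<bar>j\<bar> * real (2 * s choose (s + nat \<bar>j\<bar>))))
    (at (real s) within {0<..} - \<nat>)"
proof -
  define m where "m = nat \<bar>j\<bar>"
  let ?F = "at (real s) within {0<..} - \<nat>"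
  have pos: "x \<notin> \<int>\<^sub>\<le>\<^sub>0" if "x > 0" for x :: real
    using that nonpos_Ints_nonpos by force
  have "((\<lambda>z. - (4 powr z * Gamma (1 / 2 + z) / sqrt pi * pochhammer (- z) m / Gamma (real m + 1 + z)))
     \<longlongrightarrow> - (4 powr real s * Gamma (1 / 2 + real s) / sqrt pi * pochhammer (- real s) m
             / Gamma (real m + 1 + real s))) ?F"
    unfolding pochhammer_prod
    by (intro tendsto_intros tendsto_Gamma pos) (auto simp: Gamma_eq_zero_iff intro!: pos)
  also have "4 powr real s * Gamma (1 / 2 + real s) / sqrt pi = fact (2 * s) / fact s"
    using Gamma_half_plus_nat[of s] by (simp add: powr_realpow)
  also have "Gamma (real m + 1 + real s) = fact (m + s)"
    using Gamma_fact[of "m + s", where ?'a = real] by (simp add: add_ac)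
  also note central_binomial_eq_pochhammer
  finally show ?thesis unfolding m_def[symmetric]
    by (rule Lim_transform_eventually)
       (auto simp: eventually_at_filter frac_kernel_eq_pochhammer assms m_def)
qed

text \<open>The central index \<open>k = s\<close>, where \<open>K\<^sub>z(0) = 0\<close> is not the limit formula, does no harm: the
  difference of \<open>u\<close> is zero there.\<close>

lemma tendsto_frac_kernel_diff:
  assumes "k \<le> 2 * s"
  shows "((\<lambda>z. frac_kernel z (n - (n - int s + int k)) * (u n - u (n - int s + int k))) \<longlongrightarrow>
      (- 1) powi (int k - int s) * real (2 * s choose k) * (u (n - int s + int k) - u n))
    (at (real s) within {0<..} - \<nat>)"
proof (cases "k = s")
  case False
  define m where "m = nat \<bar>int s - int k\<bar>"
  have m: "m = s - k \<and> k \<le> s \<or> m = k - s \<and> s \<le> k" unfolding m_def by auto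
  have "(2 * s choose (s + m)) = (2 * s choose k)"
    using m assms binomial_symmetric[of k "2 * s"] by (auto simp: mult_2)
  moreover have "(- 1 :: real) ^ m = (- 1) powi (int k - int s)"
    using m by (auto simp: minus_one_powi_diff minus_one_power_iff)
  ultimately have "((\<lambda>z. frac_kernel z (int s - int k)) \<longlongrightarrow>
      - ((- 1) powi (int k - int s) * real (2 * s choose k))) (at (real s) within {0<..} - \<nat>)"
    using tendsto_frac_kernel[of "int s - int k" s] False by (simp add: m_def)
  from tendsto_mult_right[OF this, of "u n - u (n - int s + int k)"] show ?thesis
    by (simp add: algebra_simps)
qed simp

lemma alternating_central_binomial_sum:
  assumes "s \<ge> 1"
  shows "(\<Sum>k = 0..2 * s. (- 1) powi (int k - int s) * real (2 * s choose k)) = 0"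
proof -
  have "(\<Sum>k = 0..2 * s. (- 1) powi (int k - int s) * real (2 * s choose k)) =
      (- 1) ^ s * (\<Sum>k\<le>2 * s. (- 1) ^ k * real (2 * s choose k))"
    by (simp add: minus_one_powi_diff power_add sum_distrib_left atLeast0AtMost mult_ac)
  also have "\<dots> = 0" using assms by (simp add: choose_alternating_sum)
  finally show ?thesis .
qed

section \<open>Splitting off the tail\<close>

lemma frac_kernel_split:
  fixes n :: int
  assumes z: "z \<notin> \<nat>" "0 < z" "z \<le> real (Suc s)" and v: "\<And>k. \<bar>v k\<bar> \<le> C"
  defines "T \<equiv> {k. int (Suc s) \<le> \<bar>n - k\<bar>}"
  shows "(\<lambda>k. frac_kernel z (n - k) * v k) summable_on UNIV"
    and "(\<Sum>\<^sub>\<infinity>k. frac_kernel z (n - k) * v k) =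
      (\<Sum>k = 0..2 * s. frac_kernel z (n - (n - int s + int k)) * v (n - int s + int k)) +
      (\<Sum>\<^sub>\<infinity>k\<in>T. frac_kernel z (n - k) * v k)"
proof -
  let ?f = "\<lambda>k. frac_kernel z (n - k) * v k"
  let ?c = "\<lambda>k. n - int s + int k"
  have univ: "UNIV = ?c ` {0..2 * s} \<union> T"
  proof -
    have "k = ?c (nat (k - n + int s)) \<and> nat (k - n + int s) \<in> {0..2 * s}" if "k \<notin> T" for k
      using that by (auto simp: T_def)
    then show ?thesis by blast
  qed
  have disj: "?c ` {0..2 * s} \<inter> T = {}" by (auto simp: T_def)
  have fin: "?f summable_on ?c ` {0..2 * s}" by (intro summable_on_finite) simp
  have tail: "?f summable_on T"
    unfolding T_def using z v by (intro frac_kernel_tail_bounded) auto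
  show "?f summable_on UNIV"
    unfolding univ by (rule summable_on_Un_disjoint[OF fin tail disj])
  have "infsum ?f UNIV = sum ?f (?c ` {0..2 * s}) + infsum ?f T"
    using infsum_Un_disjoint[OF fin tail disj] unfolding univ[symmetric] by simp
  also have "sum ?f (?c ` {0..2 * s}) = (\<Sum>k = 0..2 * s. ?f (?c k))"
    by (simp add: sum.reindex inj_on_def)
  finally show "infsum ?f UNIV = (\<Sum>k = 0..2 * s. ?f (?c k)) + infsum ?f T" .
qed

lemma bounded_if_ell2_int:
  assumes "u \<in> ell2_int" obtains C where "\<And>k. \<bar>u k\<bar> \<le> C"
proof
  fix k
  have "(\<Sum>i\<in>{k}. \<bar>u i\<bar>^2) \<le> (\<Sum>\<^sub>\<infinity>i. \<bar>u i\<bar>^2)"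
    using assms unfolding ell2_int_def by (intro finite_sum_le_infsum) auto
  then show "\<bar>u k\<bar> \<le> sqrt (\<Sum>\<^sub>\<infinity>i. \<bar>u i\<bar>^2)"
    by (intro real_le_rsqrt) simp
qed

theorem lemma6p3:
  fixes s :: nat and u :: "int \<Rightarrow> real" and n :: int
  assumes "s \<ge> 1" and "u \<in> ell2_int"
  shows "(neg_discrete_laplacian ^^ s) u n =
           (\<Sum>k = 0..2 * s. (- 1) powi (int k - int s) * real (2 * s choose k) * u (n - int s + int k))
       \<and> (\<forall>z \<in> {0<..} - \<nat>. (\<lambda>k. frac_kernel z (n - k) * (u n - u k)) summable_on UNIV)
       \<and> ((\<lambda>z. \<Sum>\<^sub>\<infinity>k\<in>UNIV. frac_kernel z (n - k) * (u n - u k)) \<longlongrightarrow>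
           (\<Sum>k = 0..2 * s. (- 1) powi (int k - int s) * real (2 * s choose k) * u (n - int s + int k)))
          (at (real s) within {0<..} - \<nat>)"
proof (intro conjI ballI)
  obtain C where C: "\<bar>u k\<bar> \<le> C" for k
    using bounded_if_ell2_int[OF assms(2)] by blast
  have v: "\<bar>u n - u k\<bar> \<le> 2 * C" for k
    using abs_triangle_ineq4[of "u n" "u k"] C[of n] C[of k] by linarith
  show "(neg_discrete_laplacian ^^ s) u n =
      (\<Sum>k = 0..2 * s. (- 1) powi (int k - int s) * real (2 * s choose k) * u (n - int s + int k))"
    by (rule neg_discrete_laplacian_funpow)
  show "(\<lambda>k. frac_kernel z (n - k) * (u n - u k)) summable_on UNIV" if "z \<in> {0<..} - \<nat>" for z
  proof -
    \<comment> \<open>Any cut beyond \<open>z\<close> will do.\<close>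
    obtain r where "z \<le> real r" using real_arch_simple by blast
    then show ?thesis using that by (intro frac_kernel_split(1)[of z r _ "2 * C"] v) auto
  qed
  let ?F = "at (real s) within {0<..} - \<nat>"
  let ?f = "\<lambda>z k. frac_kernel z (n - k) * (u n - u k)"
  let ?w = "\<lambda>k. (- 1) powi (int k - int s) * real (2 * s choose k)"
  let ?T = "{k. int (Suc s) \<le> \<bar>n - k\<bar>}"
  let ?B = "\<lambda>z. 2 * C * ((real (Suc s) + z) * \<bar>frac_kernel z (int (Suc s))\<bar> / z)"
  have near: "eventually (\<lambda>z. z \<notin> \<nat> \<and> 0 < z \<and> z \<le> real (Suc s)) ?F"
  proof -
    have "eventually (\<lambda>z. z < real (Suc s)) ?F"
      by (intro order_tendstoD(2)[OF tendsto_ident_at]) simp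
    moreover have "eventually (\<lambda>z. z \<in> {0<..} - \<nat>) ?F"
      by (auto simp: eventually_at_filter)
    ultimately show ?thesis by eventually_elim auto
  qed
  \<comment> \<open>The limit is \<open>2 * s choose (2 * s + 1) = 0\<close>, up to sign.\<close>
  have "((\<lambda>z. frac_kernel z (int (Suc s))) \<longlongrightarrow> 0) ?F"
    using tendsto_frac_kernel[of "int (Suc s)" s] by (simp add: nat_add_distrib binomial_eq_0)
  then have "(?B \<longlongrightarrow> 2 * C * ((real (Suc s) + real s) * \<bar>0\<bar> / real s)) ?F"
    using assms(1) by (intro tendsto_intros) auto
  then have "(?B \<longlongrightarrow> 0) ?F" by simp
  moreover have "eventually (\<lambda>z. norm (infsum (?f z) ?T) \<le> ?B z) ?F"
    using near
  proof eventually_elim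
    case (elim z)
    then show ?case
      unfolding real_norm_def by (intro frac_kernel_tail_bounded(2) v) auto
  qed
  ultimately have tail: "((\<lambda>z. infsum (?f z) ?T) \<longlongrightarrow> 0) ?F"
    by (rule Lim_null_comparison[rotated])
  have "((\<lambda>z. (\<Sum>k = 0..2 * s. ?f z (n - int s + int k)) + infsum (?f z) ?T) \<longlongrightarrow>
      (\<Sum>k = 0..2 * s. ?w k * (u (n - int s + int k) - u n)) + 0) ?F"
    by (intro tendsto_add tail tendsto_sum tendsto_frac_kernel_diff) simp
  also have "(\<Sum>k = 0..2 * s. ?w k * (u (n - int s + int k) - u n)) + 0 =
      (\<Sum>k = 0..2 * s. ?w k * u (n - int s + int k)) - (\<Sum>k = 0..2 * s. ?w k) * u n"
    by (simp add: right_diff_distrib sum_subtractf sum_distrib_right)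
  also have "\<dots> = (\<Sum>k = 0..2 * s. ?w k * u (n - int s + int k))"
    using alternating_central_binomial_sum[OF assms(1)] by simp
  finally have "((\<lambda>z. (\<Sum>k = 0..2 * s. ?f z (n - int s + int k)) + infsum (?f z) ?T) \<longlongrightarrow>
      (\<Sum>k = 0..2 * s. ?w k * u (n - int s + int k))) ?F" .
  moreover have "eventually (\<lambda>z. (\<Sum>k = 0..2 * s. ?f z (n - int s + int k)) + infsum (?f z) ?T =
      infsum (?f z) UNIV) ?F"
    using near
  proof eventually_elim
    case (elim z)
    then show ?case by (intro frac_kernel_split(2)[where C = "2 * C", symmetric] v) auto
  qed
  ultimately show "((\<lambda>z. infsum (?f z) UNIV) \<longlongrightarrow> (\<Sum>k = 0..2 * s. ?w k * u (n - int s + int k))) ?F"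
    by (rule Lim_transform_eventually)
qed

end
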